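(* Let $n \ge 1$. Let $T$ be a triangulation of a set homeomorphic to $B^n$ that is antipodally symmetric on the boundary and aligned with hemispheres, via a sequence $T^n = T, T^{n-1}, \ldots, T^0$. Fix a finite strictly symmetric label set $\Lambda$ and let $F \subseteq \bigcup_{i=0}^n L^i$ be a set of forbidden labellings with $F \cap L^0 = \emptyset$ such that $L^i \setminus F$ is strictly symmetric for every $i = 0, \ldots, n$. Let $\lambda : V(T) \to \Lambda$ be a label function with $\lambda(v) = -\lambda(-v)$ for every vertex $v$ on the boundary, and suppose that no simplex of $T$ has its labelling in $F$. Define $M^0 := L^0$. Then, inductively for $i = 1, \ldots, n$, the following hold: $M^{i-1}$ is strictly symmetric, so it can be partitioned (arbitrarily) as $M^{i-1}_+ \cup M^{i-1}_-$ by choosing, from each pair of opposite labellings, one to lie in $M^{i-1}_+$ and the other in $M^{i-1}_-$; and if $M^i$ is defined to be the set of $i$-labellings $\ell^i \in L^i \setminus F$ that contain an odd number of $(i-1)$-labellings from $M^{i-1}_+$, then $T^i$ contains an odd number of $i$-simplices whose labellings lie in $M^i$. (This holds for every choice of the partitions at every stage.)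
   Context: A triangulation of a set $X\subset\mathbb{R}^n$ is a finite family of simplices whose union is $X$, closed under faces, with any two simplices meeting in a common face; $V(T)$ is its vertex set. For $T$ a triangulation of $X$ homeomorphic to $B^n$, $\partial(T)$ is the set of simplices of $T$ lying in the boundary $\partial(X)$; $T$ is antipodally symmetric on the boundary if $\sigma \in \partial(T)$ implies $-\sigma \in \partial(T)$. $T$ is aligned with hemispheres if there is a sequence $T^n = T, T^{n-1}, \ldots, T^0$, where each $T^i$ is a triangulation of a set homeomorphic to $B^i$ that is antipodally symmetric on the boundary, such that $T^{i-1} \cup (-T^{i-1}) = \partial(T^i)$ and $T^{i-1} \cap (-T^{i-1}) = \partial(T^{i-1})$ (here $-S = \{-\sigma : \sigma \in S\}$). A label set is strictly symmetric if it is equipped with a fixed-point-free involution $a \mapsto -a$ (i.e. it is partitioned into pairs of opposite labels). An $i$-labelling is a multiset of $i+1$ labels (the labelling of an $i$-simplex is the multiset of labels of its vertices); $L^i$ denotes the set of all $i$-labellings, and the opposite $-\ell$ of a labelling $\ell$ is obtained by negating each label. A set $M$ of $i$-labellings is strictly symmetric if $\ell \in M$ implies $-\ell \in M$ and no $\ell \in M$ equals $-\ell$. The $(i-1)$-labellings contained in an $i$-labelling $\ell^i$ are the $i+1$ multisets obtained by deleting one element of $\ell^i$ (counted with multiplicity, one for each of the $i+1$ positions, i.e. the labellings of the $i+1$ facets of a simplex labelled $\ell^i$).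
   Formalization: Added hypothesis: for i < n, every i-labelling containing a forbidden (i−1)-labelling is itself in F (vacuous for n ≤ 2). Without it M^2 need not be symmetric: n = 3, F = all {a,−a} and {a,−a,b,−b}; {1,−1,2} can lie in M^2 while its opposite does not. *)

theory Defs
  imports "HOL-Analysis.Analysis" "HOL-Library.Multiset"
begin

section \<open>Triangulated balls\<close>

text \<open>
  Triangulations closed under faces are the library's \<^const>\<open>simplicial_complex\<close>. The empty set
  counts there as a simplex (of dimension -1) and as a face of every simplex. The closed ball of
  dimension i is modelled, for all i at once, as the unit ball of an i-dimensional linear subspace
  of the ambient space.
\<close>

definition triangulated_ball :: "nat \<Rightarrow> 'a::euclidean_space set set \<Rightarrow> bool" where
  "triangulated_ball i T \<longleftrightarrow>
     simplicial_complex T \<and>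
     (\<exists>B :: 'a set. subspace B \<and> dim B = i \<and> \<Union>T homeomorphic (cball 0 1 \<inter> B))"

text \<open>
  The boundary of a set homeomorphic to a ball is its boundary as a manifold, that is, the image of
  the unit sphere. By invariance of domain it does not depend on the homeomorphism, and if the
  dimension of the ball is that of the ambient space it is the topological frontier.
\<close>

definition ball_boundary :: "'a::euclidean_space set \<Rightarrow> 'a set" where
  "ball_boundary X =
     {x. \<exists>(B :: 'a set) h k. subspace B \<and> homeomorphism (cball 0 1 \<inter> B) X h k \<and> x \<in> h ` (sphere 0 1 \<inter> B)}"

definition boundary_complex :: "'a::euclidean_space set set \<Rightarrow> 'a set set" where
  "boundary_complex T = {\<sigma> \<in> T. \<sigma> \<subseteq> ball_boundary (\<Union>T)}"

definition complex_vertices :: "'a::euclidean_space set set \<Rightarrow> 'a set" where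
  "complex_vertices T = {v. {v} \<in> T}"

definition antipodal :: "'a::euclidean_space set set \<Rightarrow> 'a set set" where
  "antipodal T = (\<lambda>\<sigma>. uminus ` \<sigma>) ` T"

definition antipodally_symmetric_boundary :: "'a::euclidean_space set set \<Rightarrow> bool" where
  "antipodally_symmetric_boundary T \<longleftrightarrow>
     (\<forall>\<sigma> \<in> boundary_complex T. uminus ` \<sigma> \<in> boundary_complex T)"

definition hemisphere_sequence ::
    "nat \<Rightarrow> 'a::euclidean_space set set \<Rightarrow> (nat \<Rightarrow> 'a set set) \<Rightarrow> bool" where
  "hemisphere_sequence n T Ts \<longleftrightarrow>
     Ts n = T \<and>
     (\<forall>i\<le>n. triangulated_ball i (Ts i) \<and> antipodally_symmetric_boundary (Ts i)) \<and>
     (\<forall>i\<in>{1..n}. Ts (i - 1) \<union> antipodal (Ts (i - 1)) = boundary_complex (Ts i) \<and>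
                 Ts (i - 1) \<inter> antipodal (Ts (i - 1)) = boundary_complex (Ts (i - 1)))"


section \<open>Labellings\<close>

definition symmetric_labels :: "('l \<Rightarrow> 'l) \<Rightarrow> 'l set \<Rightarrow> bool" where
  "symmetric_labels neg \<Lambda> \<longleftrightarrow> (\<forall>a\<in>\<Lambda>. neg a \<in> \<Lambda> \<and> neg (neg a) = a \<and> neg a \<noteq> a)"

definition labellings :: "'l set \<Rightarrow> nat \<Rightarrow> 'l multiset set" where
  "labellings \<Lambda> i = {l. size l = i + 1 \<and> set_mset l \<subseteq> \<Lambda>}"

definition strictly_symmetric :: "('l \<Rightarrow> 'l) \<Rightarrow> 'l multiset set \<Rightarrow> bool" where
  "strictly_symmetric neg M \<longleftrightarrow> (\<forall>l\<in>M. image_mset neg l \<in> M \<and> image_mset neg l \<noteq> l)"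

definition simplex_labelling :: "('a::euclidean_space \<Rightarrow> 'l) \<Rightarrow> 'a set \<Rightarrow> 'l multiset" where
  "simplex_labelling lab \<sigma> = image_mset lab (mset_set {v. v extreme_point_of \<sigma>})"

text \<open>Deleting one element in each position; the result has the size of l.\<close>

definition facet_labellings :: "'l multiset \<Rightarrow> 'l multiset multiset" where
  "facet_labellings l = image_mset (\<lambda>a. l - {#a#}) l"

definition opposite_partition ::
    "('l \<Rightarrow> 'l) \<Rightarrow> 'l multiset set \<Rightarrow> 'l multiset set \<Rightarrow> 'l multiset set \<Rightarrow> bool" where
  "opposite_partition neg M P N \<longleftrightarrow>
     P \<union> N = M \<and> P \<inter> N = {} \<and>
     (\<forall>l\<in>P. image_mset neg l \<in> N) \<and> (\<forall>l\<in>N. image_mset neg l \<in> P)"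

text \<open>
  Here P j is the positive part chosen at stage j; the value at stage i depends only on the choices
  at the stages below i.
\<close>

primrec odd_labellings ::
    "'l set \<Rightarrow> 'l multiset set \<Rightarrow> (nat \<Rightarrow> 'l multiset set) \<Rightarrow> nat \<Rightarrow> 'l multiset set" where
  "odd_labellings \<Lambda> F P 0 = labellings \<Lambda> 0"
| "odd_labellings \<Lambda> F P (Suc i) =
     {l \<in> labellings \<Lambda> (Suc i) - F. odd (size (filter_mset (\<lambda>m. m \<in> P i) (facet_labellings l)))}"

end

(*
  Count the incidences between the i-simplices of T^i and their facets labelled in M^(i-1)_+. An
  i-simplex is in M^i exactly if it has an odd number of such facets. A facet lies in one i-simplex
  if it is in the boundary and in two otherwise, which is where the topology of the ball enters,
  through invariance of domain. So the number of i-simplices in M^i has the parity of the number of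
  boundary facets in M^(i-1)_+. The boundary is the union of two antipodal hemispheres, and the
  antipode of a facet in M^(i-1)_- is one in M^(i-1)_+, so this number is the number of facets of
  the single hemisphere T^(i-1) in M^(i-1), which is odd by induction.
*)

theory Submission
  imports Defs
begin

section \<open>Boundary of a triangulated ball\<close>

text \<open>That a facet lies in at most two full-dimensional simplices is not part of
  \<open>triangulated_ball\<close>; only a homeomorphism with a ball is given, so the number of
  cofaces has to be read off from the topology. For i below n the complex T^i may be curved inside
  the ambient space. Hence invariance of domain is applied between flats: affine hulls of simplices
  on one side, the subspace carrying the model ball on the other.

  The second obstacle is the symmetry of M^i. Negating a labelling exchanges facets in M^(i-1)_+
  with facets in M^(i-1)_-, while only the former enter the definition of M^i. The two counts have
  the same parity because an allowed labelling has an even number of facets in M^(i-1), a statement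
  of the kind "the boundary of a boundary vanishes modulo 2". It relies on facets of allowed
  labellings being allowed, which \<open>F_upward_closed\<close> provides.\<close>

lemma homeomorphism_imp_inj_on: "homeomorphism S T f g \<Longrightarrow> inj_on f S"
  by (metis homeomorphism_def inj_on_inverseI)

text \<open>By invariance of domain \<open>k \<circ> g\<close> has an image open in
  \<open>B\<close>, and a subset of the closed unit ball that is open in \<open>B\<close> cannot
  touch the sphere. So a continuous injection into \<open>X\<close> from an open piece of a flat of
  at least the dimension of the ball is a chart of the interior.\<close>

lemma ball_embedding:
  fixes X :: "'a::euclidean_space set" and B :: "'c::euclidean_space set"
    and g :: "'b::euclidean_space \<Rightarrow> 'a"
  assumes "subspace B" and hom: "homeomorphism (cball 0 1 \<inter> B) X h k"
    and "affine A" "int (dim B) \<le> aff_dim A" and U: "openin (top_of_set A) U"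
    and g: "continuous_on U g" "inj_on g U" "g ` U \<subseteq> X"
  shows "openin (top_of_set X) (g ` U)" and "g ` U \<inter> h ` (sphere 0 1 \<inter> B) = {}"
proof -
  let ?C = "cball 0 1 \<inter> B"
  have k: "continuous_on X k" "k ` X = ?C" "\<And>y. y \<in> X \<Longrightarrow> h (k y) = y" "h ` ?C = X"
    "\<And>b. b \<in> ?C \<Longrightarrow> k (h b) = b"
    using hom unfolding homeomorphism_def by auto
  have sub: "(k \<circ> g) ` U \<subseteq> ?C" using g(3) k(2) by auto
  have "openin (top_of_set B) ((k \<circ> g) ` U)"
  proof (rule invariance_of_domain_affine_sets [where f = "k \<circ> g", OF U \<open>affine A\<close>])
    show "affine B" "aff_dim B \<le> aff_dim A"
      using assms by (auto simp: subspace_imp_affine aff_dim_subspace)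
    show "continuous_on U (k \<circ> g)"
      using g k(1) by (meson continuous_on_compose continuous_on_subset)
    show "inj_on (k \<circ> g) U"
      using g k(3) by (intro comp_inj_on inj_on_inverseI [where g = h]) auto
    show "k \<circ> g \<in> U \<rightarrow> B" using sub by auto
  qed
  then obtain W where W: "open W" "(k \<circ> g) ` U = B \<inter> W" by (auto simp: openin_open)
  have ball: "(k \<circ> g) ` U \<subseteq> ball 0 1"
  proof
    fix b assume b: "b \<in> (k \<circ> g) ` U"
    have "b \<in> W" using b W by blast
    then obtain e where e: "e > 0" "ball b e \<subseteq> W" using W(1) open_contains_ball by metis
    have bB: "b \<in> B" "norm b \<le> 1" using b sub by auto
    show "b \<in> ball 0 1"
    proof (cases "b = 0")
      case False
      \<comment> \<open>Stretching \<open>b\<close> radially by this factor moves it by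
        \<open>e / 2\<close>, so it stays in the image and hence in the closed ball; this forces
        \<open>norm b < 1\<close>.\<close>
      define d where "d = e / (2 * norm b)"
      have d: "d > 0" using e False by (simp add: d_def)
      have "(1 + d) *\<^sub>R b \<in> B" using bB \<open>subspace B\<close> by (simp add: subspace_scale)
      moreover have "dist b ((1 + d) *\<^sub>R b) < e"
        using e False by (simp add: dist_norm algebra_simps d_def)
      ultimately have "(1 + d) *\<^sub>R b \<in> (k \<circ> g) ` U" using e W by auto
      then have "(1 + d) *\<^sub>R b \<in> ?C" using sub by (rule subsetD [rotated])
      then have "norm ((1 + d) *\<^sub>R b) \<le> 1" by simp
      moreover have "norm b < (1 + d) * norm b" using d False by simp
      ultimately show ?thesis using d by simp
    qed simp
  qed
  have "openin (top_of_set ?C) ((k \<circ> g) ` U)"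
    using W sub by (auto simp: openin_open)
  then have "openin (top_of_set X) (h ` ((k \<circ> g) ` U))"
    using homeomorphism_imp_open_map [OF hom] by blast
  moreover have "h ` ((k \<circ> g) ` U) = g ` U"
    using g(3) k(3) by (force simp: image_comp)
  ultimately show "openin (top_of_set X) (g ` U)" by simp
  show "g ` U \<inter> h ` (sphere 0 1 \<inter> B) = {}"
  proof (rule ccontr)
    assume "g ` U \<inter> h ` (sphere 0 1 \<inter> B) \<noteq> {}"
    then obtain u b where ub: "u \<in> U" "b \<in> sphere 0 1 \<inter> B" "g u = h b" by blast
    then have "k (g u) = b" using k(5) [of b] by auto
    moreover have "k (g u) \<in> ball 0 1" using ball ub(1) by auto
    ultimately show False using ub by simp
  qed
qed

text \<open>All parametrisations of \<open>X\<close> give the same sphere: apply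
  \<open>ball_embedding\<close> to the open ball of one and the sphere of the other. Their subspaces
  may differ, so the dimension inequality that this needs is proved separately as
  \<open>*\<close>.\<close>

lemma ball_boundary_eq:
  fixes X B :: "'a::euclidean_space set"
  assumes "subspace B" and hom: "homeomorphism (cball 0 1 \<inter> B) X h k"
  shows "ball_boundary X = h ` (sphere 0 1 \<inter> B)"
proof -
  have *: "dim B \<le> dim B'" 
    if "subspace B" "homeomorphism (cball 0 1 \<inter> B) X h k" 
      "subspace B'" "homeomorphism (cball 0 1 \<inter> B') X h' k'"
    for B B' :: "'a set" and h k h' k'
  proof -
    have hom: "homeomorphism (cball 0 1 \<inter> B) (cball 0 1 \<inter> B') (k' \<circ> h) (k \<circ> h')"
      using homeomorphism_compose [OF that(2) homeomorphism_symD [OF that(4)]] .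
    then have c: "continuous_on (cball 0 1 \<inter> B) (k' \<circ> h)" "inj_on (k' \<circ> h) (cball 0 1 \<inter> B)"
      "(k' \<circ> h) ` (cball 0 1 \<inter> B) \<subseteq> B'"
      using homeomorphism_imp_inj_on [OF hom] by (auto simp: homeomorphism_def)
    show ?thesis
    proof (rule invariance_of_dimension_subspaces [of B "ball 0 1 \<inter> B" B' "k' \<circ> h"])
      show "openin (top_of_set B) (ball 0 1 \<inter> B)" by (auto simp: openin_open)
      show "continuous_on (ball 0 1 \<inter> B) (k' \<circ> h)"
        by (rule continuous_on_subset [OF c(1)]) auto
      show "inj_on (k' \<circ> h) (ball 0 1 \<inter> B)"
        by (rule inj_on_subset [OF c(2)]) auto
      show "k' \<circ> h \<in> ball 0 1 \<inter> B \<rightarrow> B'" using c(3) by (auto simp: subset_iff)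
      show "ball 0 1 \<inter> B \<noteq> {}" using subspace_0 [OF that(1)] by (metis IntI centre_in_ball empty_iff zero_less_one)
    qed (use that in auto)
  qed
  have "h' ` (sphere 0 1 \<inter> B') \<subseteq> h ` (sphere 0 1 \<inter> B)"
    if B': "subspace B'" "homeomorphism (cball 0 1 \<inter> B') X h' k'" for B' :: "'a set" and h' k'
  proof -
    have h: "continuous_on (cball 0 1 \<inter> B) h" "inj_on h (cball 0 1 \<inter> B)" "h ` (cball 0 1 \<inter> B) = X"
      using hom homeomorphism_imp_inj_on [OF hom] unfolding homeomorphism_def by auto
    have "h ` (ball 0 1 \<inter> B) \<inter> h' ` (sphere 0 1 \<inter> B') = {}"
    proof (rule ball_embedding(2) [OF B', of B])
      show "openin (top_of_set B) (ball 0 1 \<inter> B)" by (auto simp: openin_open)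
      show "int (dim B') \<le> aff_dim B"
        using *[OF B' assms] by (simp add: aff_dim_subspace \<open>subspace B\<close>)
      show "continuous_on (ball 0 1 \<inter> B) h"
        by (rule continuous_on_subset [OF h(1)]) auto
      show "inj_on h (ball 0 1 \<inter> B)"
        by (rule inj_on_subset [OF h(2)]) auto
      show "h ` (ball 0 1 \<inter> B) \<subseteq> X" using h(3) by auto
    qed (simp add: \<open>subspace B\<close> subspace_imp_affine)
    moreover have "h' ` (sphere 0 1 \<inter> B') \<subseteq> X" using B'(2) by (auto simp: homeomorphism_def)
    moreover have "X = h ` (ball 0 1 \<inter> B) \<union> h ` (sphere 0 1 \<inter> B)"
      unfolding h(3) [symmetric] image_Un [symmetric] by (intro arg_cong [where f = "image h"]) auto
    ultimately show ?thesis by blast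
  qed
  then show ?thesis unfolding ball_boundary_def using assms by blast
qed

lemma triangulated_ballE:
  fixes T :: "'a::euclidean_space set set"
  assumes "triangulated_ball i T"
  obtains B :: "'a set" and h k where "subspace B" "dim B = i"
    "homeomorphism (cball 0 1 \<inter> B) (\<Union>T) h k" "ball_boundary (\<Union>T) = h ` (sphere 0 1 \<inter> B)"
proof -
  obtain B :: "'a set" where B: "subspace B" "dim B = i" "(cball 0 1 \<inter> B) homeomorphic \<Union>T"
    using assms homeomorphic_sym unfolding triangulated_ball_def by metis
  then obtain h k where "homeomorphism (cball 0 1 \<inter> B) (\<Union>T) h k" by (auto simp: homeomorphic_def)
  with B that ball_boundary_eq show ?thesis by blast
qed

text \<open>\<open>k\<close> embeds the convex set \<open>\<tau>\<close> in the subspace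
  \<open>B\<close>, and a continuous injection cannot lower dimension.\<close>

lemma simplex_dim_le:
  fixes T :: "'a::euclidean_space set set"
  assumes "triangulated_ball i T" "\<tau> \<in> T" "m simplex \<tau>"
  shows "m \<le> int i"
proof -
  obtain B :: "'a set" and h k where B: "subspace B" "dim B = i"
    "homeomorphism (cball 0 1 \<inter> B) (\<Union>T) h k"
    using triangulated_ballE [OF assms(1)] by metis
  have "aff_dim \<tau> \<le> aff_dim B"
  proof (rule invariance_of_dimension_convex_domain [where f = k])
    show "convex \<tau>" using assms(3) convex_simplex by blast
    have k: "continuous_on (\<Union>T) k" "k ` \<Union>T = cball 0 1 \<inter> B" "inj_on k (\<Union>T)"
      using B(3) homeomorphism_imp_inj_on [OF homeomorphism_symD [OF B(3)]]
      unfolding homeomorphism_def by auto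
    have "\<tau> \<subseteq> \<Union>T" using assms(2) by blast
    then show "continuous_on \<tau> k" "inj_on k \<tau>"
      using k(1,3) by (meson continuous_on_subset inj_on_subset)+
    have "k ` \<tau> \<subseteq> B" using k(2) \<open>\<tau> \<subseteq> \<Union>T\<close> by blast
    then show "k \<in> \<tau> \<rightarrow> affine hull B" using hull_inc by (metis Pi_I image_subset_iff)
  qed
  then show ?thesis using assms(3) B by (simp add: aff_dim_simplex aff_dim_subspace)
qed

text \<open>The relative interior is open in an affine hull of full dimension, so the identity is a
  chart to which \<open>ball_embedding\<close> applies. In the final count this keeps the two
  hemispheres from sharing a full-dimensional simplex.\<close>

lemma top_simplex_not_in_boundary:
  fixes T :: "'a::euclidean_space set set"
  assumes "triangulated_ball i T" "\<tau> \<in> T" "int i simplex \<tau>"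
  shows "\<not> \<tau> \<subseteq> ball_boundary (\<Union>T)"
proof -
  obtain B :: "'a set" and h k where B: "subspace B" "dim B = i"
    "homeomorphism (cball 0 1 \<inter> B) (\<Union>T) h k" "ball_boundary (\<Union>T) = h ` (sphere 0 1 \<inter> B)"
    using triangulated_ballE [OF assms(1)] by metis
  have ad: "aff_dim \<tau> = int i" using assms(3) by (rule aff_dim_simplex)
  then have "\<tau> \<noteq> {}" by auto
  then have "rel_interior \<tau> \<noteq> {}" 
    using assms(3) convex_simplex rel_interior_eq_empty by blast
  moreover have "id ` rel_interior \<tau> \<inter> h ` (sphere 0 1 \<inter> B) = {}"
    by (rule ball_embedding(2) [OF B(1,3), of "affine hull \<tau>"])
      (use assms(2) rel_interior_subset in \<open>auto simp: B(2) ad openin_rel_interior\<close>)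
  ultimately show ?thesis using B(4) rel_interior_subset by fastforce
qed

section \<open>Simplices containing a simplex of codimension one\<close>

text \<open>The point equals \<open>(1 - t) *\<^sub>R (x + r *\<^sub>R v) + t *\<^sub>R a\<close>
  with \<open>r = 1 / (1 - t)\<close>, a convex combination of \<open>a\<close> and a point that
  lies in \<open>S\<close> once \<open>v\<close> is small.\<close>

lemma cone_contains_half_neighbourhood:
  fixes S :: "'a::euclidean_space set"
  assumes "convex S" "x \<in> rel_interior S"
  shows "\<exists>e>0. \<forall>v t. x + v \<in> affine hull S \<longrightarrow> norm v < e \<longrightarrow> 0 \<le> t \<longrightarrow> t < e \<longrightarrow>
    x + v + t *\<^sub>R (a - x) \<in> convex hull (insert a S)"
proof -
  obtain d where d: "d > 0" "ball x d \<inter> affine hull S \<subseteq> S" and xS: "x \<in> S"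
    using assms(2) by (auto simp: mem_rel_interior_ball)
  \<comment> \<open>With \<open>t\<close> below 1/2 the factor \<open>r\<close> is at most 2, and
    \<open>norm v\<close> below \<open>d/2\<close> then keeps \<open>r *\<^sub>R v\<close> shorter
    than \<open>d\<close>.\<close>
  define e where "e = min (1/2) (d/2)"
  have "x + v + t *\<^sub>R (a - x) \<in> convex hull (insert a S)"
    if v: "x + v \<in> affine hull S" "norm v < e" and t: "0 \<le> t" "t < e" for v t
  proof -
    have t2: "t < 1/2" using t by (simp add: e_def)
    define r where "r = 1 / (1 - t)"
    have r: "0 < r" "r \<le> 2" "(1 - t) * r = 1" using t2 t by (auto simp: r_def field_simps)
    have "x + r *\<^sub>R v = (1 - r) *\<^sub>R x + r *\<^sub>R (x + v)" by (simp add: algebra_simps)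
    also have "\<dots> \<in> affine hull S"
      by (rule mem_affine [OF affine_affine_hull]) (use v hull_inc[OF xS] in auto)
    finally have 1: "x + r *\<^sub>R v \<in> affine hull S" .
    have "r * norm v \<le> 2 * norm v" using r by (intro mult_right_mono) auto
    then have "dist x (x + r *\<^sub>R v) < d" using v(2) r by (simp add: dist_norm e_def)
    with 1 d have "x + r *\<^sub>R v \<in> S" by auto
    then have "(1 - t) *\<^sub>R (x + r *\<^sub>R v) + t *\<^sub>R a \<in> convex hull (insert a S)"
      using t t2 by (intro convexD [OF convex_convex_hull]) (auto intro: hull_inc)
    moreover have "(1 - t) *\<^sub>R (x + r *\<^sub>R v) + t *\<^sub>R a = (1 - t) *\<^sub>R x + ((1 - t) * r) *\<^sub>R v + t *\<^sub>R a"
      by (simp add: scaleR_add_right)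
    moreover have "\<dots> = x + v + t *\<^sub>R (a - x)"
      unfolding r(3) by (simp add: algebra_simps)
    ultimately show ?thesis by simp
  qed
  moreover have "e > 0" using d by (simp add: e_def)
  ultimately show ?thesis by blast
qed

text \<open>
  The map is the identity on the side of \<open>a\<close> and sends the direction \<open>x - a\<close> to \<open>b - x\<close>.
\<close>

lemma two_sheets_embedding:
  fixes S :: "'a::euclidean_space set"
  assumes S: "convex S" and x: "x \<in> rel_interior S"
    and a: "a \<notin> affine hull S" and b: "b \<notin> affine hull S"
    and ab: "convex hull (insert a S) \<inter> convex hull (insert b S) \<subseteq> affine hull S"
  obtains U g where "openin (top_of_set (affine hull (insert a S))) U"
    "continuous_on U g" "inj_on g U" "x \<in> g ` U"
    "g ` U \<subseteq> convex hull (insert a S) \<union> convex hull (insert b S)"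
proof -
  have xS: "x \<in> affine hull S" using x rel_interior_subset hull_subset by (metis subsetD)
  define D where "D = {v. x + v \<in> affine hull S}"
  have "D = (\<lambda>y. (-x) + y) ` (affine hull S)"
    by (force simp: D_def image_iff algebra_simps)
  then have D: "subspace D"
    using affine_diffs_subspace [OF affine_affine_hull xS] by (simp add: image_def)
  have aD: "a - x \<notin> D" and bD: "b - x \<notin> D" using a b by (auto simp: D_def)
  obtain y z where yz: "y \<in> span D" "\<And>w. w \<in> span D \<Longrightarrow> orthogonal z w" "a - x = y + z"
    using orthogonal_subspace_decomp_exists [of D "a - x"] by metis
  have sD: "span D = D" using D by (simp add: span_eq_iff)
  have z0: "z \<noteq> 0" using yz aD sD by auto
  \<comment> \<open>\<open>z\<close> is the part of \<open>a - x\<close> orthogonal to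
    \<open>D\<close>, the direction space of \<open>affine hull S\<close>. So \<open>\<phi>\<close>
    is the coordinate along \<open>a - x\<close>, normalised to 1 at \<open>a\<close> and 0 on
    \<open>affine hull S\<close>; the remainder \<open>dv\<close> lies in \<open>D\<close> on
    \<open>affine hull (insert a S)\<close>.\<close>
  define \<phi> where "\<phi> p = (z \<bullet> (p - x)) / (z \<bullet> z)" for p
  have \<phi>a: "\<phi> a = 1" using yz z0 by (simp add: \<phi>_def inner_add_right orthogonal_def)
  have \<phi>S: "\<phi> p = 0" if "p \<in> affine hull S" for p
  proof -
    have "p - x \<in> D" using that by (simp add: D_def)
    then show ?thesis using yz(2) sD by (simp add: \<phi>_def orthogonal_def)
  qed
  have cont: "continuous_on X \<phi>" for X unfolding \<phi>_def by (intro continuous_intros) (use z0 in auto)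
  define dv where "dv p = p - x - \<phi> p *\<^sub>R (a - x)" for p
  have dvD: "dv p \<in> D" if "p \<in> affine hull (insert a S)" for p
  proof -
    have "affine {p. dv p \<in> D}"
      unfolding affine_def
    proof (intro ballI allI impI)
      fix p q and u v :: real assume pq: "p \<in> {p. dv p \<in> D}" "q \<in> {p. dv p \<in> D}" and uv: "u + v = 1"
      have x: "x = u *\<^sub>R x + v *\<^sub>R x" using uv by (metis scaleR_left_distrib scaleR_one)
      have eq: "u *\<^sub>R p + v *\<^sub>R q - x = u *\<^sub>R (p - x) + v *\<^sub>R (q - x)"
        by (subst (1) x) (simp add: algebra_simps)
      have "\<phi> (u *\<^sub>R p + v *\<^sub>R q) = u * \<phi> p + v * \<phi> q"
        unfolding \<phi>_def eq by (simp add: inner_add_right add_divide_distrib)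
      then have "dv (u *\<^sub>R p + v *\<^sub>R q) = u *\<^sub>R dv p + v *\<^sub>R dv q"
        unfolding dv_def eq by (simp add: algebra_simps)
      then show "u *\<^sub>R p + v *\<^sub>R q \<in> {p. dv p \<in> D}"
        using pq D by (simp add: subspace_add subspace_scale)
    qed
    moreover have "insert a S \<subseteq> {p. dv p \<in> D}"
      using \<phi>a \<phi>S xS subspace_0 [OF D] by (auto simp: dv_def D_def hull_inc)
    ultimately show ?thesis using that hull_minimal by (metis mem_Collect_eq subsetD)
  qed
  have split: "p = x + dv p + \<phi> p *\<^sub>R (a - x)" for p by (simp add: dv_def)
  obtain e1 where e1: "e1 > 0" 
    "\<And>v t. v \<in> D \<Longrightarrow> norm v < e1 \<Longrightarrow> 0 \<le> t \<Longrightarrow> t < e1 \<Longrightarrow> x + v + t *\<^sub>R (a - x) \<in> convex hull (insert a S)"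
    using cone_contains_half_neighbourhood [OF S x, of a] unfolding D_def mem_Collect_eq by meson
  obtain e2 where e2: "e2 > 0" 
    "\<And>v t. v \<in> D \<Longrightarrow> norm v < e2 \<Longrightarrow> 0 \<le> t \<Longrightarrow> t < e2 \<Longrightarrow> x + v + t *\<^sub>R (b - x) \<in> convex hull (insert b S)"
    using cone_contains_half_neighbourhood [OF S x, of b] unfolding D_def mem_Collect_eq by meson
  define e where "e = min e1 e2"
  define W where "W = {p. norm (dv p) < e} \<inter> {p. \<bar>\<phi> p\<bar> < e}"
  define U where "U = affine hull (insert a S) \<inter> W"
  define g where "g p = x + dv p + (if 0 \<le> \<phi> p then \<phi> p *\<^sub>R (a - x) else (- \<phi> p) *\<^sub>R (b - x))" for p
  have "open W"
    unfolding W_def dv_def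
    by (intro open_Int open_Collect_less continuous_intros cont)
  then have "openin (top_of_set (affine hull (insert a S))) U"
    by (auto simp: U_def openin_open)
  moreover have "continuous_on U g"
  proof -
    \<comment> \<open>Replacing the case distinction by \<open>max\<close> makes continuity across
      \<open>\<phi> p = 0\<close> evident.\<close>
    have "g = (\<lambda>p. x + dv p + max 0 (\<phi> p) *\<^sub>R (a - x) + max 0 (- \<phi> p) *\<^sub>R (b - x))"
      by (auto simp: g_def max_def fun_eq_iff)
    then show ?thesis unfolding dv_def by (auto intro!: continuous_intros cont)
  qed
  moreover have gpos: "g p \<in> convex hull (insert a S)" if "p \<in> U" "0 \<le> \<phi> p" for p
    using that e1(2) [of "dv p" "\<phi> p"] dvD by (auto simp: U_def W_def g_def e_def)
  moreover have gneg: "g p \<in> convex hull (insert b S)" if "p \<in> U" "\<not> 0 \<le> \<phi> p" for p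
    using that e2(2) [of "dv p" "- \<phi> p"] dvD by (auto simp: U_def W_def g_def e_def)
  moreover have "x \<in> g ` U"
  proof
    have "dv x = 0" using \<phi>S [OF xS] by (simp add: dv_def)
    then show "x = g x" "x \<in> U"
      using \<phi>S [OF xS] e1(1) e2(1) xS hull_mono[of S "insert a S" affine]
      by (auto simp: g_def U_def W_def e_def)
  qed
  moreover have "inj_on g U"
  proof -
    \<comment> \<open>The common image would lie in both cones, hence in
      \<open>affine hull S\<close> by \<open>ab\<close>. On the side of \<open>b\<close>, however,
      it differs from a point of that hull by a positive multiple of \<open>b - x\<close>, which is
      not in \<open>D\<close>.\<close>
    have mixed: False if pq: "p \<in> U" "q \<in> U" "0 \<le> \<phi> p" "\<not> 0 \<le> \<phi> q" "g p = g q" for p q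
    proof -
      have "g q \<in> affine hull S" using gpos [OF pq(1,3)] gneg [OF pq(2,4)] pq(5) ab by auto
      then have "dv q + (- \<phi> q) *\<^sub>R (b - x) \<in> D" using pq(4) by (simp add: g_def D_def add_diff_eq)
      then have "(- \<phi> q) *\<^sub>R (b - x) \<in> D"
        using dvD pq(2) D by (metis Int_iff U_def add_diff_cancel_left' subspace_diff)
      then have "(1 / - \<phi> q) *\<^sub>R ((- \<phi> q) *\<^sub>R (b - x)) \<in> D" using D subspace_scale by blast
      then show False using bD pq(4) by simp
    qed
    show ?thesis
    proof (rule inj_onI)
      fix p q assume pq: "p \<in> U" "q \<in> U" "g p = g q"
      consider "0 \<le> \<phi> p" "0 \<le> \<phi> q" | "\<not> 0 \<le> \<phi> p" "\<not> 0 \<le> \<phi> q"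
        using mixed [OF pq(1,2) _ _ pq(3)] mixed [OF pq(2,1) _ _ pq(3) [symmetric]] by blast
      then show "p = q"
      proof cases
        case 1
        then show ?thesis using pq(3) by (simp add: g_def flip: split)
      next
        case 2
        then have eq: "dv p - dv q = (\<phi> p - \<phi> q) *\<^sub>R (b - x)" using pq(3) by (simp add: g_def algebra_simps)
        have "dv p - dv q \<in> D" using pq dvD D by (simp add: U_def subspace_diff)
        \<comment> \<open>If the coordinates differed, this would put \<open>b - x\<close> into
          \<open>D\<close>. If they agree, the quotient is 0 by convention and the membership is
          trivial.\<close>
        then have "(1 / (\<phi> p - \<phi> q)) *\<^sub>R ((\<phi> p - \<phi> q) *\<^sub>R (b - x)) \<in> D" 
          unfolding eq using D subspace_scale by blast
        then have "\<phi> p = \<phi> q" using bD by (cases "\<phi> p = \<phi> q") auto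
        moreover from this eq have "dv p = dv q" by simp
        ultimately show ?thesis by (metis split)
      qed
    qed
  qed
  ultimately show ?thesis using that [of U g] gpos gneg by (metis (no_types, lifting) UnI1 UnI2 image_subsetI)
qed

text \<open>A dimension count leaves exactly one vertex of \<open>\<tau>\<close> outside the vertex
  set of \<open>\<sigma>\<close>; it becomes the apex of a sheet in
  \<open>two_sheets_embedding\<close>.\<close>

lemma simplex_facet_insert:
  fixes \<sigma> \<tau> :: "'a::euclidean_space set"
  assumes "\<sigma> face_of \<tau>" "m simplex \<sigma>" "(m + 1) simplex \<tau>"
  obtains a where "a \<notin> affine hull \<sigma>" "\<tau> = convex hull (insert a \<sigma>)"
proof -
  obtain C where C: "finite C" "\<not> affine_dependent C" "int (card C) = m + 2" "\<tau> = convex hull C"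
    using assms(3) unfolding simplex by auto
  then obtain c where c: "c \<subseteq> C" "\<sigma> = convex hull c"
    using assms(1) face_of_convex_hull_affine_independent by blast
  have indep: "\<not> affine_dependent c" using C(2) c(1) affine_independent_subset by blast
  have "int (card c) = m + 1"
    using aff_dim_simplex [OF assms(2)] aff_dim_affine_independent [OF indep] c(2)
    by (simp add: aff_dim_convex_hull)
  then have "card (C - c) = 1"
    using C c finite_subset by (subst card_Diff_subset) auto
  then obtain a where a: "C - c = {a}" by (auto simp: card_1_singleton_iff)
  then have Ca: "C = insert a c" "a \<notin> c" using c(1) by auto
  have "a \<notin> affine hull c"
    using C(2) Ca by (metis Diff_insert_absorb affine_dependent_def insertI1)
  moreover have "affine hull c = affine hull \<sigma>" by (simp add: c(2) affine_hull_convex_hull)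
  moreover have "convex hull (insert a \<sigma>) = convex hull (insert a c)"
    unfolding c(2) by (rule hull_insert [symmetric])
  ultimately show ?thesis using that C(4) Ca(1) by simp
qed

lemma face_of_same_aff_dim:
  fixes S T :: "'a::euclidean_space set"
  assumes "S face_of T" "convex T" "aff_dim S = aff_dim T"
  shows "S = T"
  using face_of_aff_dim_lt assms by fastforce

text \<open>The intersection is a face of both simplices, and a face of \<open>\<sigma>\<close> that
  meets its relative interior is all of \<open>\<sigma>\<close>.\<close>

lemma simplicial_complex_face_if_meets_rel_interior:
  assumes T: "simplicial_complex T" "\<sigma> \<in> T" "\<tau> \<in> T" and x: "x \<in> rel_interior \<sigma>" "x \<in> \<tau>"
  shows "\<sigma> face_of \<tau>"
proof -
  have int: "\<sigma> \<inter> \<tau> face_of \<sigma>" "\<tau> \<inter> \<sigma> face_of \<tau>"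
    using T unfolding simplicial_complex_def by auto
  have "\<sigma> \<subseteq> \<sigma> \<inter> \<tau>"
    using subset_of_face_of [OF int(1), of \<sigma>] x rel_interior_subset [of \<sigma>] by auto
  then have "\<tau> \<inter> \<sigma> = \<sigma>" by blast
  then show ?thesis using int(2) by simp
qed

text \<open>
  At a point in the relative interior of a codimension-one simplex \<open>\<sigma>\<close>, the space is a
  union of sheets, one for each top-dimensional simplex containing \<open>\<sigma>\<close>. Without a sheet its
  dimension would be too small, a single sheet has the point on its edge, and two sheets together
  already form an open set, which excludes a third.
\<close>

lemma odd_card_cofaces_iff:
  fixes T :: "'a::euclidean_space set set"
  assumes ball: "triangulated_ball (Suc j) T" and \<sigma>: "\<sigma> \<in> T" "int j simplex \<sigma>"
  shows "odd (card {\<tau> \<in> T. int (Suc j) simplex \<tau> \<and> \<sigma> face_of \<tau>}) \<longleftrightarrow> \<sigma> \<subseteq> ball_boundary (\<Union>T)"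
proof -
  define X where "X = \<Union>T"
  define S where "S = {\<tau> \<in> T. int (Suc j) simplex \<tau> \<and> \<sigma> face_of \<tau>}"
  have T: "simplicial_complex T" using ball by (simp add: triangulated_ball_def)
  have finT: "finite T" using T by (simp add: simplicial_complex_def)
  then have finS: "finite S" by (simp add: S_def)
  obtain B :: "'a set" and h k where B: "subspace B" "dim B = Suc j"
    and hom: "homeomorphism (cball 0 1 \<inter> B) X h k"
    and bd: "ball_boundary X = h ` (sphere 0 1 \<inter> B)"
    using triangulated_ballE [OF ball] unfolding X_def by metis
  have h: "continuous_on (cball 0 1 \<inter> B) h" "inj_on h (cball 0 1 \<inter> B)" "h ` (cball 0 1 \<inter> B) = X"
    using hom homeomorphism_imp_inj_on [OF hom] unfolding homeomorphism_def by auto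
  have S: "\<tau> \<in> T" "convex \<tau>" "aff_dim \<tau> = int (Suc j)" "\<sigma> face_of \<tau>" "\<sigma> \<noteq> \<tau>" "\<tau> \<subseteq> X" if "\<tau> \<in> S" for \<tau>
    using that \<sigma>(2) aff_dim_simplex [of "int (Suc j)" \<tau>] aff_dim_simplex [of "int j" \<sigma>] convex_simplex
    by (auto simp: S_def X_def)
  have S_eq: "\<tau> = \<rho>" if "\<tau> \<in> S" "\<rho> \<in> S" "y \<in> rel_interior \<tau>" "y \<in> \<rho>" for \<tau> \<rho> y
  proof -
    have "\<tau> face_of \<rho>"
      using simplicial_complex_face_if_meets_rel_interior T S that by metis
    then show ?thesis using face_of_same_aff_dim S that by metis
  qed
  \<comment> \<open>The intersection is a proper face of \<open>\<tau>\<close>, so of dimension at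
    most j, and has the j-dimensional \<open>\<sigma>\<close> as a face.\<close>
  have meet: "\<tau> \<inter> \<rho> = \<sigma>" if "\<tau> \<in> S" "\<rho> \<in> S" "\<tau> \<noteq> \<rho>" for \<tau> \<rho>
  proof -
    have F: "\<tau> \<inter> \<rho> face_of \<tau>" "\<rho> \<inter> \<tau> face_of \<rho>"
      using T S(1) that unfolding simplicial_complex_def by auto
    have "\<tau> \<inter> \<rho> \<noteq> \<tau>" 
    proof
      assume "\<tau> \<inter> \<rho> = \<tau>"
      then have "\<tau> face_of \<rho>" using F(2) by (simp add: Int_commute)
      then show False using face_of_same_aff_dim S that by metis
    qed
    then have lt: "aff_dim (\<tau> \<inter> \<rho>) < int (Suc j)"
      using face_of_aff_dim_lt [OF S(2) F(1)] S(3) that(1) by simp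
    have "\<sigma> \<subseteq> \<tau> \<inter> \<rho>" using S(4) that face_of_imp_subset by blast
    then have face: "\<sigma> face_of \<tau> \<inter> \<rho>"
      using S(4) [OF that(1)] F(1) face_of_subset face_of_imp_subset by blast
    show ?thesis
    proof (rule ccontr)
      assume "\<tau> \<inter> \<rho> \<noteq> \<sigma>"
      then have "aff_dim \<sigma> < aff_dim (\<tau> \<inter> \<rho>)"
        using face_of_aff_dim_lt [OF _ face] S(2) that by (metis convex_Int)
      then show False using lt aff_dim_simplex [OF \<sigma>(2)] by simp
    qed
  qed
  have star: "\<tau> \<in> S \<or> \<tau> = \<sigma>" if x\<tau>: "x \<in> rel_interior \<sigma>" "\<tau> \<in> T" "x \<in> \<tau>" for x \<tau>
  proof (rule disjCI)
    assume ne: "\<tau> \<noteq> \<sigma>"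
    have face: "\<sigma> face_of \<tau>"
      using simplicial_complex_face_if_meets_rel_interior T \<sigma>(1) x\<tau> by metis
    obtain m where m: "m simplex \<tau>" using T x\<tau>(2) by (auto simp: simplicial_complex_def)
    have "aff_dim \<sigma> < aff_dim \<tau>" using face_of_aff_dim_lt [OF _ face] ne m convex_simplex by metis
    then have "int j < m" using m \<sigma>(2) by (simp add: aff_dim_simplex)
    moreover have "m \<le> int (Suc j)" using simplex_dim_le [OF ball x\<tau>(2) m] .
    ultimately have "m = int (Suc j)" by simp
    then show "\<tau> \<in> S" using m face x\<tau>(2) by (simp add: S_def)
  qed
  \<comment> \<open>Removing the finitely many closed simplices that miss \<open>x\<close> leaves an
    open set in which only the simplices described by \<open>star\<close> are visible.\<close>
  have near: "\<exists>N. open N \<and> x \<in> N \<and> X \<inter> N \<subseteq> \<sigma> \<union> \<Union>S" if x: "x \<in> rel_interior \<sigma>" for x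
  proof (intro exI conjI)
    show "open (- \<Union>{\<tau> \<in> T. x \<notin> \<tau>})"
    proof (rule open_Compl, rule closed_Union)
      show "\<forall>\<tau>\<in>{\<tau> \<in> T. x \<notin> \<tau>}. closed \<tau>"
        using T closed_simplex unfolding simplicial_complex_def by blast
    qed (use finT in simp)
    show "X \<inter> - \<Union>{\<tau> \<in> T. x \<notin> \<tau>} \<subseteq> \<sigma> \<union> \<Union>S"
      using star [OF x] unfolding X_def by blast
  qed simp
  have conv\<sigma>: "convex \<sigma>" and dim\<sigma>: "aff_dim \<sigma> = int j" using \<sigma>(2) convex_simplex aff_dim_simplex by auto
  have "\<sigma> \<noteq> {}" using dim\<sigma> by auto
  then obtain x0 where x0: "x0 \<in> rel_interior \<sigma>" using conv\<sigma> rel_interior_eq_empty by blast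
  have memX: "x \<in> X" if "x \<in> rel_interior \<sigma>" for x
    using that \<sigma>(1) rel_interior_subset unfolding X_def by blast

  \<comment> \<open>Otherwise \<open>h\<close> would embed a small convex piece \<open>C\<close> of
    the model ball in the hull of \<open>\<sigma>\<close>. Intersecting a convex set with an open
    set that it meets preserves the dimension, so \<open>C\<close> has dimension j + 1, which is too
    large.\<close>
  have nonempty: "S \<noteq> {}"
  proof
    assume "S = {}"
    then obtain N where N: "open N" "x0 \<in> N" "X \<inter> N \<subseteq> \<sigma>" using near [OF x0] by auto
    obtain b where b: "b \<in> cball 0 1 \<inter> B" "h b = x0" using memX [OF x0] h(3) by blast
    have "openin (top_of_set (cball 0 1 \<inter> B)) (cball 0 1 \<inter> B \<inter> h -` N)"
      using continuous_openin_preimage_gen h(1) N(1) by blast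
    then obtain W where W: "open W" "cball 0 1 \<inter> B \<inter> h -` N = cball 0 1 \<inter> B \<inter> W"
      by (auto simp: openin_open)
    have bW: "b \<in> W" using b N(2) W(2) by blast
    then obtain e where e: "e > 0" "ball b e \<subseteq> W" using W(1) open_contains_ball by metis
    define C where "C = cball 0 1 \<inter> B \<inter> ball b e"
    have hC: "h ` C \<subseteq> \<sigma>" using W(2) e(2) N(3) h(3) unfolding C_def by blast
    have convC: "convex (cball 0 1 \<inter> B)" using B(1) by (simp add: convex_Int subspace_imp_convex)
    have "aff_dim C = aff_dim (cball 0 1 \<inter> B)"
      unfolding C_def by (rule aff_dim_convex_Int_open [OF convC]) (use b e in auto)
    also have "\<dots> \<ge> aff_dim (B \<inter> ball 0 1)" by (rule aff_dim_subset) auto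
    moreover have "aff_dim (B \<inter> ball 0 1) = aff_dim B"
      by (rule aff_dim_convex_Int_open)
        (use B subspace_0 [OF B(1)] in \<open>auto simp: subspace_imp_convex intro!: exI [of _ 0]\<close>)
    moreover have "aff_dim C \<le> aff_dim \<sigma>"
    proof (rule invariance_of_dimension_convex_domain [where f = h])
      show "convex C" using convC by (simp add: C_def convex_Int)
      show "continuous_on C h" "inj_on h C"
        using h(1,2) by (auto simp: C_def intro: continuous_on_subset inj_on_subset)
      show "h \<in> C \<rightarrow> affine hull \<sigma>" using hC hull_inc by (metis Pi_I image_subset_iff)
    qed
    ultimately show False using dim\<sigma> B by (simp add: aff_dim_subspace)
  qed

  \<comment> \<open>An interior point of the ball would have a neighbourhood mapped by
    \<open>h\<close> into \<open>\<tau>\<close>. Its image is open in the hull of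
    \<open>\<tau>\<close> and so lies in the relative interior, whereas \<open>x\<close> lies on the
    proper face \<open>\<sigma>\<close>.\<close>
  have single: "rel_interior \<sigma> \<subseteq> ball_boundary X" if S\<tau>: "S = {\<tau>}" for \<tau>
  proof
    fix x assume x: "x \<in> rel_interior \<sigma>"
    obtain N where N: "open N" "x \<in> N" "X \<inter> N \<subseteq> \<tau>"
      using near [OF x] S(4) [of \<tau>] S\<tau> face_of_imp_subset by (metis ccpo_Sup_singleton insertI1 sup.absorb2)
    have \<tau>: "\<tau> \<in> S" using that by simp
    show "x \<in> ball_boundary X"
    proof (rule ccontr)
      assume nb: "x \<notin> ball_boundary X"
      obtain b where b: "b \<in> cball 0 1 \<inter> B" "h b = x" using memX [OF x] h(3) by blast
      have "b \<notin> sphere 0 1 \<inter> B" using nb b(2) unfolding bd by blast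
      then have bb: "b \<in> ball 0 1 \<inter> B" using b(1) by auto
      define U where "U = ball 0 1 \<inter> B \<inter> h -` N"
      have hb: "continuous_on (ball 0 1 \<inter> B) h"
        by (rule continuous_on_subset [OF h(1)]) auto
      have "openin (top_of_set (ball 0 1 \<inter> B)) U"
        unfolding U_def using continuous_openin_preimage_gen hb N(1) by blast
      moreover have "openin (top_of_set B) (ball 0 1 \<inter> B)" by (auto simp: openin_open)
      ultimately have U: "openin (top_of_set B) U" by (rule openin_trans)
      have sub: "h ` U \<subseteq> \<tau>" using N(3) h(3) ball_subset_cball unfolding U_def by blast
      have "openin (top_of_set (affine hull \<tau>)) (h ` U)"
      proof (rule invariance_of_domain_affine_sets [OF U])
        show "continuous_on U h" "inj_on h U"
          using h(1,2) by (auto simp: U_def intro: continuous_on_subset inj_on_subset)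
        show "h \<in> U \<rightarrow> affine hull \<tau>" using sub hull_inc by (metis Pi_I image_subset_iff)
      qed (use B S(3) [OF \<tau>] in \<open>auto simp: subspace_imp_affine aff_dim_subspace\<close>)
      then have "h ` U \<subseteq> rel_interior \<tau>" using sub rel_interior_maximal by blast
      then have "x \<in> rel_interior \<tau>" using b bb N(2) by (auto simp: U_def)
      then show False
        using face_of_disjoint_rel_interior [OF S(4,5) [OF \<tau>]] x rel_interior_subset by blast
    qed
  qed

  \<comment> \<open>The two sheets form a chart at \<open>x0\<close>, which excludes the boundary. A
    third simplex \<open>\<upsilon>\<close> has \<open>x0\<close> in the closure of its relative
    interior; since the chart is open in \<open>X\<close>, that relative interior meets
    \<open>\<tau>\<close> or \<open>\<rho>\<close>, and \<open>S_eq\<close> identifies the two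
    simplices.\<close>
  have double: "S = {\<tau>, \<rho>} \<and> \<not> \<sigma> \<subseteq> ball_boundary X" if \<tau>: "\<tau> \<in> S" and \<rho>: "\<rho> \<in> S" and ne: "\<tau> \<noteq> \<rho>" for \<tau> \<rho>
  proof -
    have si: "(int j + 1) simplex \<tau>" "(int j + 1) simplex \<rho>" using \<tau> \<rho> by (auto simp: S_def algebra_simps)
    obtain a where a: "a \<notin> affine hull \<sigma>" "\<tau> = convex hull (insert a \<sigma>)"
      using simplex_facet_insert S(4) [OF \<tau>] \<sigma>(2) si(1) by metis
    obtain b where b: "b \<notin> affine hull \<sigma>" "\<rho> = convex hull (insert b \<sigma>)"
      using simplex_facet_insert S(4) [OF \<rho>] \<sigma>(2) si(2) by metis
    have "convex hull (insert a \<sigma>) \<inter> convex hull (insert b \<sigma>) \<subseteq> affine hull \<sigma>"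
      using meet [OF \<tau> \<rho> ne] hull_subset a(2) b(2) by metis
    then obtain U g where U: "openin (top_of_set (affine hull (insert a \<sigma>))) U"
      and g: "continuous_on U g" "inj_on g U" "x0 \<in> g ` U" "g ` U \<subseteq> \<tau> \<union> \<rho>"
      using two_sheets_embedding [OF conv\<sigma> x0 a(1) b(1)] a(2) b(2) by metis
    have dimA: "int (dim B) \<le> aff_dim (affine hull (insert a \<sigma>))"
      using S(3) [OF \<tau>] B(2) a(2) by (simp add: aff_dim_convex_hull)
    have gX: "g ` U \<subseteq> X" using g(4) S(6) \<tau> \<rho> by blast
    note emb = ball_embedding [OF B(1) hom affine_affine_hull dimA U g(1,2) gX]
    have "x0 \<notin> ball_boundary X" using emb(2) g(3) unfolding bd by blast
    then have nb: "\<not> \<sigma> \<subseteq> ball_boundary X" using x0 rel_interior_subset by blast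
    have "\<upsilon> = \<tau> \<or> \<upsilon> = \<rho>" if \<upsilon>: "\<upsilon> \<in> S" for \<upsilon>
    proof -
      obtain W where W: "open W" "g ` U = X \<inter> W" using emb(1) by (auto simp: openin_open)
      have "x0 \<in> \<upsilon>" using x0 rel_interior_subset S(4) [OF \<upsilon>] face_of_imp_subset by blast
      then have "x0 \<in> closure (rel_interior \<upsilon>)"
        using convex_closure_rel_interior [OF S(2) [OF \<upsilon>]] closure_subset by blast
      then have "W \<inter> rel_interior \<upsilon> \<noteq> {}"
        using W g(3) open_Int_closure_eq_empty by blast
      then obtain y where y: "y \<in> W" "y \<in> rel_interior \<upsilon>" by blast
      then have "y \<in> X" using rel_interior_subset S(6) [OF \<upsilon>] by blast
      then have "y \<in> \<tau> \<union> \<rho>" using y(1) W(2) g(4) by blast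
      then show ?thesis using S_eq [OF \<upsilon> _ y(2)] \<tau> \<rho> by blast
    qed
    then show ?thesis using nb \<tau> \<rho> by blast
  qed

  have "odd (card S) \<longleftrightarrow> \<sigma> \<subseteq> ball_boundary X"
  proof (cases "\<exists>\<tau>. S = {\<tau>}")
    case True
    then obtain \<tau> where \<tau>: "S = {\<tau>}" by blast
    \<comment> \<open>\<open>single\<close> only reaches the relative interior of
      \<open>\<sigma>\<close>; as the boundary is the image of a compact sphere, it contains the
      closure too.\<close>
    have "closed (ball_boundary X)"
    proof -
      have "compact (sphere 0 1 \<inter> B)" using B(1) by (simp add: closed_subspace compact_Int_closed)
      moreover have "continuous_on (sphere 0 1 \<inter> B) h" by (rule continuous_on_subset [OF h(1)]) auto
      ultimately show ?thesis unfolding bd by (simp add: compact_continuous_image compact_imp_closed)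
    qed
    then have "closure (rel_interior \<sigma>) \<subseteq> ball_boundary X"
      using single [OF \<tau>] closure_minimal by blast
    then have "\<sigma> \<subseteq> ball_boundary X"
      using convex_closure_rel_interior [OF conv\<sigma>] closure_subset by blast
    then show ?thesis using \<tau> by simp
  next
    case False
    then obtain \<tau> \<rho> where "\<tau> \<in> S" "\<rho> \<in> S" and ne: "\<tau> \<noteq> \<rho>" using nonempty by blast
    then have "S = {\<tau>, \<rho>} \<and> \<not> \<sigma> \<subseteq> ball_boundary X" by (rule double)
    then show ?thesis using ne by (metis card_2_iff even_numeral)
  qed
  then show ?thesis by (simp add: S_def X_def)
qed

section \<open>Labellings of simplices and their facets\<close>

lemma simplex_injective_linear_image:
  assumes "linear f" "inj f" "m simplex S"
  shows "m simplex (f ` S)"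
proof -
  obtain C where C: "\<not> affine_dependent C" "int (card C) = m + 1" "S = convex hull C"
    using assms(3) by (auto simp: simplex_def)
  have "card (f ` C) = card C" using assms(2) by (meson card_image inj_on_subset subset_UNIV)
  moreover have "\<not> affine_dependent (f ` C)"
    using C(1) aff_dim_injective_linear_image [OF assms(1,2)] calculation
    by (simp add: affine_independent_iff_card)
  ultimately show ?thesis
    using C convex_hull_linear_image [OF assms(1)] by (auto simp: simplex_def)
qed

lemma simplex_uminus_iff: "m simplex (uminus ` S) \<longleftrightarrow> m simplex S"
proof -
  have u: "linear (uminus :: 'a \<Rightarrow> 'a)" "inj (uminus :: 'a \<Rightarrow> 'a)"
    using linear_uminus by (auto simp: fun_Compl_def)
  have "uminus ` uminus ` S = S" by (simp add: image_image)
  then show ?thesis using simplex_injective_linear_image [OF u] by metis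
qed

lemma extreme_points_linear_image:
  assumes "linear f" "inj f"
  shows "{v. v extreme_point_of (f ` S)} = f ` {v. v extreme_point_of S}"
proof -
  have "f x extreme_point_of (f ` S) \<longleftrightarrow> x extreme_point_of S" for x
    using face_of_linear_image [OF assms, of "{x}" S] by (simp add: face_of_singleton)
  moreover have "v \<in> f ` S" if "v extreme_point_of (f ` S)" for v
    using that by (simp add: extreme_point_of_def)
  ultimately show ?thesis by (auto simp: image_iff) metis
qed

lemma simplex_labelling_uminus:
  assumes "\<And>v. v extreme_point_of \<sigma> \<Longrightarrow> lab (- v) = neg (lab v)"
  shows "simplex_labelling lab (uminus ` \<sigma>) = image_mset neg (simplex_labelling lab \<sigma>)"
proof (cases "finite {v. v extreme_point_of \<sigma>}")
  case True
  have u: "linear (uminus :: 'a \<Rightarrow> 'a)" "inj (uminus :: 'a \<Rightarrow> 'a)"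
    using linear_uminus by (auto simp: fun_Compl_def)
  have "inj_on uminus {v. v extreme_point_of \<sigma>}" by simp
  then have "simplex_labelling lab (uminus ` \<sigma>) =
      image_mset lab (image_mset uminus (mset_set {v. v extreme_point_of \<sigma>}))"
    unfolding simplex_labelling_def extreme_points_linear_image [OF u]
    by (simp add: image_mset_mset_set)
  also have "\<dots> = image_mset neg (simplex_labelling lab \<sigma>)"
    unfolding simplex_labelling_def image_mset.compositionality
    by (rule image_mset_cong) (use True assms in auto)
  finally show ?thesis .
next
  \<comment> \<open>\<open>\<sigma>\<close> is an arbitrary set here. \<open>mset_set\<close> of an
    infinite set is empty, so both labellings are empty.\<close>
  case False
  have u: "linear (uminus :: 'a \<Rightarrow> 'a)" "inj (uminus :: 'a \<Rightarrow> 'a)"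
    using linear_uminus by (auto simp: fun_Compl_def)
  have "infinite (uminus ` {v. v extreme_point_of \<sigma>})" using False by (simp add: finite_image_iff)
  then show ?thesis using False
    unfolding simplex_labelling_def extreme_points_linear_image [OF u] by simp
qed

lemma simplex_labelling_convex_hull:
  fixes C :: "'a::euclidean_space set"
  assumes "\<not> affine_dependent C"
  shows "simplex_labelling lab (convex hull C) = image_mset lab (mset_set C)"
  using extreme_point_of_convex_hull_affine_independent [OF assms]
  by (simp add: simplex_labelling_def)

lemma size_simplex_labelling:
  fixes \<sigma> :: "'a::euclidean_space set"
  assumes "m simplex \<sigma>"
  shows "int (size (simplex_labelling lab \<sigma>)) = m + 1"
proof -
  obtain C where "\<not> affine_dependent C" "int (card C) = m + 1" "\<sigma> = convex hull C"
    using assms by (auto simp: simplex_def)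
  then show ?thesis by (simp add: simplex_labelling_convex_hull)
qed

text \<open>Omitting a vertex gives a bijection from the vertices to the facets, by affine
  independence. Counting positions rather than distinct multisets lets facets with equal labellings
  contribute separately.\<close>

lemma size_filter_facet_labellings:
  fixes \<tau> :: "'a::euclidean_space set"
  assumes "(m + 1) simplex \<tau>"
  shows "size (filter_mset Q (facet_labellings (simplex_labelling lab \<tau>))) =
         card {\<sigma>. \<sigma> face_of \<tau> \<and> m simplex \<sigma> \<and> Q (simplex_labelling lab \<sigma>)}"
proof -
  obtain C where C: "finite C" "\<not> affine_dependent C" "int (card C) = m + 2" "\<tau> = convex hull C"
    using assms unfolding simplex by auto
  have sub: "\<not> affine_dependent c" if "c \<subseteq> C" for c
    using that C(2) affine_independent_subset by blast
  have lab: "simplex_labelling lab (convex hull (C - {v})) = image_mset lab (mset_set C) - {#lab v#}"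
    if "v \<in> C" for v
    using that C(1) sub [of "C - {v}"]
    by (simp add: simplex_labelling_convex_hull mset_set_Diff image_mset_Diff)
  have "facet_labellings (simplex_labelling lab \<tau>) =
      image_mset (\<lambda>v. simplex_labelling lab (convex hull (C - {v}))) (mset_set C)"
    using C lab by (auto simp: facet_labellings_def simplex_labelling_convex_hull
        image_mset.compositionality comp_def intro!: image_mset_cong)
  then have "size (filter_mset Q (facet_labellings (simplex_labelling lab \<tau>))) =
      card {v \<in> C. Q (simplex_labelling lab (convex hull (C - {v})))}"
    using C(1) by (simp add: filter_mset_image_mset)
  also have "\<dots> = card {\<sigma>. \<sigma> face_of \<tau> \<and> m simplex \<sigma> \<and> Q (simplex_labelling lab \<sigma>)}"
  proof (rule bij_betw_same_card [where f = "\<lambda>v. convex hull (C - {v})"], unfold bij_betw_def, intro conjI)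
    have "u = v" if "u \<in> C" "v \<in> C" "convex hull (C - {u}) = convex hull (C - {v})" for u v
    proof (rule ccontr)
      assume "u \<noteq> v"
      then have "u \<in> convex hull (C - {v})" using that by (simp add: hull_inc)
      then have "u \<in> affine hull (C - {u})"
        using that(3) convex_hull_subset_affine_hull by blast
      then show False using C(2) that(1) by (auto simp: affine_dependent_def)
    qed
    then show "inj_on (\<lambda>v. convex hull (C - {v})) {v \<in> C. Q (simplex_labelling lab (convex hull (C - {v})))}"
      by (auto simp: inj_on_def)
    show "(\<lambda>v. convex hull (C - {v})) ` {v \<in> C. Q (simplex_labelling lab (convex hull (C - {v})))} =
        {\<sigma>. \<sigma> face_of \<tau> \<and> m simplex \<sigma> \<and> Q (simplex_labelling lab \<sigma>)}"
    proof (intro subset_antisym subsetI)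
      fix \<sigma> assume "\<sigma> \<in> (\<lambda>v. convex hull (C - {v})) ` {v \<in> C. Q (simplex_labelling lab (convex hull (C - {v})))}"
      then obtain v where v: "v \<in> C" "\<sigma> = convex hull (C - {v})" "Q (simplex_labelling lab \<sigma>)" by auto
      have "\<sigma> face_of \<tau>"
        unfolding C(4) v(2) face_of_convex_hull_affine_independent [OF C(2)] by blast
      moreover have "int (card (C - {v})) = m + 1"
        using C(1,3) v(1) card_Suc_Diff1 [of C v] by simp
      then have "m simplex \<sigma>" using sub [of "C - {v}"] v(2) by (auto simp: simplex_def)
      ultimately show "\<sigma> \<in> {\<sigma>. \<sigma> face_of \<tau> \<and> m simplex \<sigma> \<and> Q (simplex_labelling lab \<sigma>)}"
        using v(3) by simp
    next
      fix \<sigma> assume "\<sigma> \<in> {\<sigma>. \<sigma> face_of \<tau> \<and> m simplex \<sigma> \<and> Q (simplex_labelling lab \<sigma>)}"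
      then have \<sigma>: "\<sigma> face_of \<tau>" "m simplex \<sigma>" "Q (simplex_labelling lab \<sigma>)" by auto
      obtain c where c: "c \<subseteq> C" "\<sigma> = convex hull c"
        using \<sigma>(1) C(4) face_of_convex_hull_affine_independent [OF C(2)] by blast
      have "int (card c) = m + 1"
        using aff_dim_simplex [OF \<sigma>(2)] aff_dim_affine_independent [OF sub [OF c(1)]] c(2)
        by (simp add: aff_dim_convex_hull)
      then have "card (C - c) = 1"
        using C c finite_subset by (subst card_Diff_subset) auto
      then obtain v where "C - c = {v}" by (auto simp: card_1_singleton_iff)
      then have "v \<in> C" "c = C - {v}" using c(1) by auto
      then show "\<sigma> \<in> (\<lambda>v. convex hull (C - {v})) ` {v \<in> C. Q (simplex_labelling lab (convex hull (C - {v})))}"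
        using c(2) \<sigma>(3) by auto
    qed
  qed
  finally show ?thesis .
qed

section \<open>Parity of labellings in codimension two, and strict symmetry\<close>

lemma even_sum_mset_iff: "even (\<Sum>x\<in>#M. f x :: nat) \<longleftrightarrow> even (size (filter_mset (\<lambda>x. odd (f x)) M))"
  by (induction M) auto

lemma size_filter_eq_sum_mset: "size (filter_mset Q M) = (\<Sum>x\<in>#M. of_bool (Q x))"
  by (induction M) auto

text \<open>Each pair of distinct positions occurs in both orders, with equal values.\<close>

lemma even_sum_mset_pairs:
  assumes "\<And>x y. f x y = f y x"
  shows "even (\<Sum>x\<in>#M. \<Sum>y\<in>#M - {#x#}. f x y :: nat)"
proof (induction M)
  case (add a M)
  have "(\<Sum>x\<in>#M. \<Sum>y\<in>#add_mset a M - {#x#}. f x y) = (\<Sum>x\<in>#M. f x a + (\<Sum>y\<in>#M - {#x#}. f x y))"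
    by (intro arg_cong [where f = sum_mset] image_mset_cong) simp
  then have "(\<Sum>x\<in>#add_mset a M. \<Sum>y\<in>#add_mset a M - {#x#}. f x y) =
      2 * (\<Sum>x\<in>#M. f a x) + (\<Sum>x\<in>#M. \<Sum>y\<in>#M - {#x#}. f x y)"
    using assms [of _ a] by (simp add: sum_mset.distrib)
  with add show ?case by simp
qed simp

text \<open>Modulo 2 this counts ordered pairs of positions whose deletion leaves a labelling
  satisfying \<open>Q\<close>; the order of deletion does not affect the result, so the pairs
  cancel.\<close>

lemma even_odd_facet_labellings:
  "even (size (filter_mset (\<lambda>m. odd (size (filter_mset Q (facet_labellings m)))) (facet_labellings l)))"
proof -
  have "(\<Sum>m\<in>#facet_labellings l. size (filter_mset Q (facet_labellings m))) =
      (\<Sum>x\<in>#l. \<Sum>y\<in>#l - {#x#}. of_bool (Q (l - {#x#} - {#y#})))"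
    by (simp add: facet_labellings_def image_mset.compositionality comp_def size_filter_eq_sum_mset)
  also have "even \<dots>"
    by (rule even_sum_mset_pairs) (simp add: add_mset_commute)
  finally show ?thesis by (simp add: even_sum_mset_iff)
qed

lemma facet_labellings_image:
  "facet_labellings (image_mset f l) = image_mset (image_mset f) (facet_labellings l)"
  by (auto simp: facet_labellings_def image_mset.compositionality comp_def image_mset_Diff
      intro!: image_mset_cong)

lemma facet_labellings_in_labellings:
  assumes "l \<in> labellings \<Lambda> (Suc i)" "m \<in># facet_labellings l"
  shows "m \<in> labellings \<Lambda> i"
  using assms by (auto simp: facet_labellings_def labellings_def size_Diff_singleton dest: in_diffD)

lemma image_mset_neg_neg:
  assumes "symmetric_labels neg \<Lambda>" "set_mset l \<subseteq> \<Lambda>"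
  shows "image_mset neg (image_mset neg l) = l"
proof -
  have "image_mset (neg \<circ> neg) l = image_mset id l"
    by (rule image_mset_cong) (use assms in \<open>auto simp: symmetric_labels_def\<close>)
  then show ?thesis by (simp add: image_mset.compositionality)
qed

lemma opposite_partition_neg_mem_iff:
  assumes "symmetric_labels neg \<Lambda>" "opposite_partition neg M P N" "set_mset l \<subseteq> \<Lambda>"
  shows "image_mset neg l \<in> P \<longleftrightarrow> l \<in> N"
  using assms image_mset_neg_neg [OF assms(1,3)] unfolding opposite_partition_def by metis

lemma size_filter_Un_disjoint:
  assumes "P \<inter> N = {}"
  shows "size (filter_mset (\<lambda>m. m \<in> P \<union> N) M) =
    size (filter_mset (\<lambda>m. m \<in> P) M) + size (filter_mset (\<lambda>m. m \<in> N) M)"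
  using assms by (induction M) auto

lemma odd_labellings_subset: "odd_labellings \<Lambda> F P i \<subseteq> labellings \<Lambda> i"
  by (cases i) auto

text \<open>
  For positive i, the facets counted here are those having an odd number of facets in
  \<open>P (i - 1)\<close>, and every labelling of codimension two is obtained from l in two ways.
\<close>

lemma even_facets_in_odd_labellings:
  assumes l: "l \<in> labellings \<Lambda> (Suc i) - F"
    and F: "\<And>m. m \<in># facet_labellings l \<Longrightarrow> m \<notin> F"
  shows "even (size (filter_mset (\<lambda>m. m \<in> odd_labellings \<Lambda> F P i) (facet_labellings l)))"
proof (cases i)
  case 0
  \<comment> \<open>A 1-labelling has two facets, both in M^0.\<close>
  have "filter_mset (\<lambda>m. m \<in> odd_labellings \<Lambda> F P i) (facet_labellings l) = facet_labellings l"
    using facet_labellings_in_labellings [of l \<Lambda> i] l 0 by (simp add: filter_mset_eq_conv)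
  then show ?thesis using l 0 by (simp add: facet_labellings_def labellings_def)
next
  case (Suc j)
  have "filter_mset (\<lambda>m. m \<in> odd_labellings \<Lambda> F P i) (facet_labellings l) =
      filter_mset (\<lambda>m. odd (size (filter_mset (\<lambda>m. m \<in> P j) (facet_labellings m)))) (facet_labellings l)"
    by (rule filter_mset_cong) (use facet_labellings_in_labellings [of l \<Lambda> i] l F Suc in auto)
  then show ?thesis by (simp add: even_odd_facet_labellings)
qed

text \<open>The facets of \<open>l\<close> in M^(i-1) are even in number, so \<open>P\<close> and
  \<open>N\<close> receive numbers of the same parity, and negation exchanges the two. By
  \<open>closed\<close> all facets of an allowed \<open>l\<close> are allowed, which the evenness
  requires. That the opposite is allowed and differs from \<open>l\<close> comes from
  \<open>sym\<close>.\<close>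

lemma strictly_symmetric_odd_labellings:
  assumes neg: "symmetric_labels neg \<Lambda>"
    and F0: "F \<inter> labellings \<Lambda> 0 = {}"
    and sym: "strictly_symmetric neg (labellings \<Lambda> i - F)"
    and closed: "\<And>l m. l \<in> labellings \<Lambda> i \<Longrightarrow> m \<in># facet_labellings l \<Longrightarrow> m \<in> F \<Longrightarrow> l \<in> F"
    and part: "\<And>j. j < i \<Longrightarrow> opposite_partition neg (odd_labellings \<Lambda> F P j) (P j) (N j)"
  shows "strictly_symmetric neg (odd_labellings \<Lambda> F P i)"
proof (cases i)
  case 0
  then have "odd_labellings \<Lambda> F P i = labellings \<Lambda> i - F" using F0 by auto
  then show ?thesis using sym by simp
next
  case (Suc j)
  note part = part [of j, unfolded Suc, simplified]
  have "image_mset neg l \<in> odd_labellings \<Lambda> F P i \<and> image_mset neg l \<noteq> l"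
    if l: "l \<in> odd_labellings \<Lambda> F P i" for l
  proof -
    have lF: "l \<in> labellings \<Lambda> (Suc j) - F"
      and odd: "odd (size (filter_mset (\<lambda>m. m \<in> P j) (facet_labellings l)))"
      using l Suc by auto
    have "m \<notin> F" if "m \<in># facet_labellings l" for m
      using closed that lF Suc by blast
    then have "even (size (filter_mset (\<lambda>m. m \<in> P j \<union> N j) (facet_labellings l)))"
      using even_facets_in_odd_labellings [OF lF, of P] part by (simp add: opposite_partition_def)
    moreover have "P j \<inter> N j = {}" using part by (simp add: opposite_partition_def)
    ultimately have oddN: "odd (size (filter_mset (\<lambda>m. m \<in> N j) (facet_labellings l)))"
      using odd by (simp add: size_filter_Un_disjoint del: Un_iff)
    have "filter_mset (\<lambda>m. image_mset neg m \<in> P j) (facet_labellings l) =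
        filter_mset (\<lambda>m. m \<in> N j) (facet_labellings l)"
    proof (rule filter_mset_cong)
      fix m assume "m \<in># facet_labellings l"
      then have "set_mset m \<subseteq> \<Lambda>"
        using facet_labellings_in_labellings lF by (fastforce simp: labellings_def)
      then show "image_mset neg m \<in> P j \<longleftrightarrow> m \<in> N j"
        by (rule opposite_partition_neg_mem_iff [OF neg part])
    qed simp
    then have "odd (size (filter_mset (\<lambda>m. m \<in> P j) (facet_labellings (image_mset neg l))))"
      using oddN by (simp add: facet_labellings_image filter_mset_image_mset)
    then show ?thesis using sym lF Suc by (auto simp: strictly_symmetric_def)
  qed
  then show ?thesis by (simp add: strictly_symmetric_def)
qed

lemma strictly_symmetric_imp_opposite_partition:
  assumes neg: "symmetric_labels neg \<Lambda>" and M: "strictly_symmetric neg M" "M \<subseteq> labellings \<Lambda> i"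
  shows "\<exists>A B. opposite_partition neg M A B"
proof -
  \<comment> \<open>The choice is made from the pair as an unordered set, so \<open>l\<close> and
    its opposite receive the same representative.\<close>
  define r where "r l = (SOME x. x \<in> {l, image_mset neg l})" for l
  have r: "r l \<in> {l, image_mset neg l}" for l
    unfolding r_def by (rule someI_ex) blast
  have nn: "image_mset neg (image_mset neg l) = l" if "l \<in> M" for l
    using that M(2) image_mset_neg_neg [OF neg] by (auto simp: labellings_def)
  have "r (image_mset neg l) = r l" if "l \<in> M" for l
    by (simp add: r_def nn [OF that] insert_commute)
  then have "opposite_partition neg M {l \<in> M. r l = l} {l \<in> M. r l \<noteq> l}"
    using r M(1) by (fastforce simp: opposite_partition_def strictly_symmetric_def)
  then show ?thesis by blast
qed

section \<open>Counting through the hemispheres\<close>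

lemma simplex_labelling_in_labellings:
  assumes "simplicial_complex T" "\<sigma> \<in> T" "int i simplex \<sigma>" "\<And>v. {v} \<in> T \<Longrightarrow> lab v \<in> \<Lambda>"
  shows "simplex_labelling lab \<sigma> \<in> labellings \<Lambda> i"
proof -
  have "lab v \<in> \<Lambda>" if "v extreme_point_of \<sigma>" for v
    using that assms face_of_singleton unfolding simplicial_complex_def by metis
  then have "set_mset (simplex_labelling lab \<sigma>) \<subseteq> \<Lambda>"
    by (cases "finite {v. v extreme_point_of \<sigma>}") (auto simp: simplex_labelling_def)
  moreover have "size (simplex_labelling lab \<sigma>) = i + 1"
    using size_simplex_labelling [OF assms(3), of lab] by linarith
  ultimately show ?thesis by (simp add: labellings_def)
qed

lemma odd_card_step:
  fixes T H :: "'a::euclidean_space set set"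
  assumes ball: "triangulated_ball (Suc i) T" and H: "triangulated_ball i H"
    and union: "H \<union> antipodal H = boundary_complex T"
    and inter: "H \<inter> antipodal H = boundary_complex H"
    and neg: "symmetric_labels neg \<Lambda>"
    and part: "opposite_partition neg (odd_labellings \<Lambda> F P i) (P i) N"
    and notF: "\<And>\<sigma>. \<sigma> \<in> T \<Longrightarrow> simplex_labelling lab \<sigma> \<notin> F"
    and lab: "\<And>v. {v} \<in> T \<Longrightarrow> lab v \<in> \<Lambda>"
    and labneg: "\<And>v. {v} \<in> H \<Longrightarrow> lab (- v) = neg (lab v)"
    and IH: "odd (card {\<sigma> \<in> H. int i simplex \<sigma> \<and> simplex_labelling lab \<sigma> \<in> odd_labellings \<Lambda> F P i})"
  shows "odd (card {\<tau> \<in> T. int (Suc i) simplex \<tau> \<and> simplex_labelling lab \<tau> \<in> odd_labellings \<Lambda> F P (Suc i)})"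
proof -
  let ?l = "simplex_labelling lab"
  have T: "simplicial_complex T" and Hc: "simplicial_complex H"
    using ball H by (auto simp: triangulated_ball_def)
  have fin: "finite T" "finite H" using T Hc by (auto simp: simplicial_complex_def)
  have labT: "?l \<sigma> \<in> labellings \<Lambda> m" if "\<sigma> \<in> T" "int m simplex \<sigma>" for \<sigma> m
    by (rule simplex_labelling_in_labellings [OF T that lab])
  have HT: "H \<subseteq> T" using union by (auto simp: boundary_complex_def)
  define tops where "tops = {\<tau> \<in> T. int (Suc i) simplex \<tau>}"
  define facets where "facets = {\<sigma> \<in> T. int i simplex \<sigma> \<and> ?l \<sigma> \<in> P i}"
  have "(\<Sum>\<tau>\<in>tops. card {\<sigma> \<in> facets. \<sigma> face_of \<tau>}) = (\<Sum>\<sigma>\<in>facets. card {\<tau> \<in> tops. \<sigma> face_of \<tau>})"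
    by (rule sum_multicount_gen) (use fin in \<open>auto simp: tops_def facets_def\<close>)
  \<comment> \<open>Modulo 2 a sum of cardinalities is the number of odd ones; this is used on both
    sides of the double count.\<close>
  then have parity: "odd (card {\<tau> \<in> tops. odd (card {\<sigma> \<in> facets. \<sigma> face_of \<tau>})}) \<longleftrightarrow>
      odd (card {\<sigma> \<in> facets. odd (card {\<tau> \<in> tops. \<sigma> face_of \<tau>})})"
    using fin even_sum_iff [of tops "\<lambda>\<tau>. card {\<sigma> \<in> facets. \<sigma> face_of \<tau>}"]
      even_sum_iff [of facets "\<lambda>\<sigma>. card {\<tau> \<in> tops. \<sigma> face_of \<tau>}"]
    by (simp add: tops_def facets_def)
  have "?l \<tau> \<in> odd_labellings \<Lambda> F P (Suc i) \<longleftrightarrow> odd (card {\<sigma> \<in> facets. \<sigma> face_of \<tau>})"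
    if \<tau>: "\<tau> \<in> tops" for \<tau>
  proof -
    have "{\<sigma> \<in> facets. \<sigma> face_of \<tau>} = {\<sigma>. \<sigma> face_of \<tau> \<and> int i simplex \<sigma> \<and> ?l \<sigma> \<in> P i}"
      using T \<tau> unfolding facets_def tops_def simplicial_complex_def by blast
    moreover have "(int i + 1) simplex \<tau>" using \<tau> by (simp add: tops_def add.commute)
    moreover have "?l \<tau> \<in> labellings \<Lambda> (Suc i)" "?l \<tau> \<notin> F"
      using labT notF \<tau> unfolding tops_def by blast+
    ultimately show ?thesis using size_filter_facet_labellings [of "int i" \<tau> "\<lambda>m. m \<in> P i" lab] by simp
  qed
  then have tops_eq: "{\<tau> \<in> tops. odd (card {\<sigma> \<in> facets. \<sigma> face_of \<tau>})} =
      {\<tau> \<in> T. int (Suc i) simplex \<tau> \<and> ?l \<tau> \<in> odd_labellings \<Lambda> F P (Suc i)}"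
    unfolding tops_def by blast
  have "odd (card {\<tau> \<in> tops. \<sigma> face_of \<tau>}) \<longleftrightarrow> \<sigma> \<in> boundary_complex T" if "\<sigma> \<in> facets" for \<sigma>
    using that odd_card_cofaces_iff [OF ball, of \<sigma>]
    by (simp add: facets_def tops_def boundary_complex_def conj_assoc)
  then have facets_eq: "{\<sigma> \<in> facets. odd (card {\<tau> \<in> tops. \<sigma> face_of \<tau>})} =
      {\<sigma> \<in> boundary_complex T. int i simplex \<sigma> \<and> ?l \<sigma> \<in> P i}"
    unfolding facets_def boundary_complex_def by blast
  define HP where "HP = {\<sigma> \<in> H. int i simplex \<sigma> \<and> ?l \<sigma> \<in> P i}"
  define HN where "HN = {\<sigma> \<in> H. int i simplex \<sigma> \<and> ?l \<sigma> \<in> N}"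
  have antipode: "?l (uminus ` \<sigma>) \<in> P i \<longleftrightarrow> ?l \<sigma> \<in> N" if \<sigma>: "\<sigma> \<in> H" "int i simplex \<sigma>" for \<sigma>
  proof -
    have "lab (- v) = neg (lab v)" if "v extreme_point_of \<sigma>" for v
      using that labneg Hc \<sigma>(1) face_of_singleton unfolding simplicial_complex_def by metis
    then have "?l (uminus ` \<sigma>) = image_mset neg (?l \<sigma>)" by (rule simplex_labelling_uminus)
    moreover have "set_mset (?l \<sigma>) \<subseteq> \<Lambda>"
      using labT \<sigma> HT by (auto simp: labellings_def)
    ultimately show ?thesis using opposite_partition_neg_mem_iff [OF neg part] by simp
  qed
  have "{\<sigma> \<in> boundary_complex T. int i simplex \<sigma> \<and> ?l \<sigma> \<in> P i} = HP \<union> image uminus ` HN"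
    using antipode unfolding union [symmetric] HP_def HN_def antipodal_def
    by (auto simp: simplex_uminus_iff)
  moreover have "card (HP \<union> image uminus ` HN) = card HP + card (image uminus ` HN)"
  proof (rule card_Un_disjoint)
    \<comment> \<open>By \<open>inter\<close> a common i-simplex would lie in the boundary of the
      i-ball triangulated by \<open>H\<close>, where no i-simplex fits.\<close>
    have "HP \<inter> image uminus ` HN \<subseteq> {\<sigma> \<in> boundary_complex H. int i simplex \<sigma>}"
      unfolding inter [symmetric] HP_def HN_def antipodal_def by blast
    moreover have "\<sigma> \<notin> boundary_complex H" if "int i simplex \<sigma>" for \<sigma>
      using top_simplex_not_in_boundary [OF H] that by (auto simp: boundary_complex_def)
    ultimately show "HP \<inter> image uminus ` HN = {}" by blast
  qed (use fin in \<open>simp_all add: HP_def HN_def\<close>)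
  moreover have "card (image uminus ` HN) = card HN"
    by (rule card_image) (auto simp: inj_on_def inj_image_eq_iff)
  moreover have "card HP + card HN =
      card {\<sigma> \<in> H. int i simplex \<sigma> \<and> ?l \<sigma> \<in> odd_labellings \<Lambda> F P i}"
    using part fin unfolding HP_def HN_def opposite_partition_def
    by (subst card_Un_disjoint [symmetric]) (auto intro!: arg_cong [where f = card])
  ultimately have "odd (card {\<sigma> \<in> facets. odd (card {\<tau> \<in> tops. \<sigma> face_of \<tau>})})"
    using IH facets_eq by simp
  then show ?thesis using parity tops_eq by simp
qed

lemma odd_card_zero:
  fixes T :: "'a::euclidean_space set set"
  assumes ball: "triangulated_ball 0 T" and lab: "\<And>v. {v} \<in> T \<Longrightarrow> lab v \<in> \<Lambda>"
  shows "odd (card {\<sigma> \<in> T. int 0 simplex \<sigma> \<and> simplex_labelling lab \<sigma> \<in> odd_labellings \<Lambda> F P 0})"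
proof -
  obtain B :: "'a set" and h k where B: "subspace B" "dim B = 0"
    and hom: "homeomorphism (cball 0 1 \<inter> B) (\<Union>T) h k"
    using triangulated_ballE [OF ball] by metis
  have T: "simplicial_complex T" using ball by (simp add: triangulated_ball_def)
  have "cball 0 1 \<inter> B = {0}" using B subspace_0 [OF B(1)] by (auto simp: dim_eq_0)
  then have U: "\<Union>T = {h 0}" using hom by (auto simp: homeomorphism_def)
  then obtain \<sigma> where "\<sigma> \<in> T" "h 0 \<in> \<sigma>" by blast
  moreover have "\<sigma> \<subseteq> {h 0}" using U calculation(1) by blast
  ultimately have mem: "{h 0} \<in> T" by (metis empty_iff subset_singletonD)
  have "\<sigma> = {h 0}" if "\<sigma> \<in> T" "int 0 simplex \<sigma>" for \<sigma>
    using that U by (auto simp: simplex_zero)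
  then have "{\<sigma> \<in> T. int 0 simplex \<sigma> \<and> simplex_labelling lab \<sigma> \<in> odd_labellings \<Lambda> F P 0} = {{h 0}}"
  proof (intro subset_antisym subsetI)
    have "simplex_labelling lab {h 0} \<in> labellings \<Lambda> 0"
      by (rule simplex_labelling_in_labellings [OF T mem _ lab]) simp_all
    then show "\<sigma> \<in> {\<sigma> \<in> T. int 0 simplex \<sigma> \<and> simplex_labelling lab \<sigma> \<in> odd_labellings \<Lambda> F P 0}"
      if "\<sigma> \<in> {{h 0}}" for \<sigma> using that mem by simp
  qed (use \<open>\<And>\<sigma>. \<sigma> \<in> T \<Longrightarrow> int 0 simplex \<sigma> \<Longrightarrow> \<sigma> = {h 0}\<close> in blast)
  then show ?thesis by simp
qed

lemma hemisphere_sequence_mono: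
  assumes "hemisphere_sequence n T Ts" "i \<le> j" "j \<le> n"
  shows "Ts i \<subseteq> Ts j"
  using assms(2,3)
proof (induction j rule: dec_induct)
  case (step j)
  have "Ts j \<subseteq> boundary_complex (Ts (Suc j))"
    using assms(1) step.prems unfolding hemisphere_sequence_def
    by (metis Un_upper1 atLeastAtMost_iff diff_Suc_1 le_add1 plus_1_eq_Suc)
  then show ?case using step by (auto simp: boundary_complex_def)
qed simp

text \<open>\<open>P\<close> and \<open>N\<close> record the choices of all stages, of which only
  those below i matter for a given i. Symmetry of M^(i-1) is derived from the partitions up to stage
  i - 2, and the partition at stage i - 1 is assumed only for the parity claim; so each choice comes
  after the symmetry that permits it. \<open>F_upward_closed\<close> is stated below n because the
  sets to be partitioned are M^0 to M^(n-1).\<close>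

theorem mainTheorem3:
  fixes n :: nat
    and T :: "'a::euclidean_space set set"
    and Ts :: "nat \<Rightarrow> 'a set set"
    and \<Lambda> :: "'l set"
    and neg :: "'l \<Rightarrow> 'l"
    and F :: "'l multiset set"
    and lab :: "'a \<Rightarrow> 'l"
  assumes "n \<ge> 1"
    and "triangulated_ball n T"
    and "antipodally_symmetric_boundary T"
    and "hemisphere_sequence n T Ts"
    and "finite \<Lambda>"
    and "symmetric_labels neg \<Lambda>"
    and "F \<subseteq> (\<Union>i\<le>n. labellings \<Lambda> i)"
    and "F \<inter> labellings \<Lambda> 0 = {}"
    and "\<And>i. i \<le> n \<Longrightarrow> strictly_symmetric neg (labellings \<Lambda> i - F)"
    and F_upward_closed:
      "\<And>i l m. i < n \<Longrightarrow> l \<in> labellings \<Lambda> i \<Longrightarrow> m \<in># facet_labellings l \<Longrightarrow> m \<in> F \<Longrightarrow> l \<in> F"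
    and "\<And>v. v \<in> complex_vertices T \<Longrightarrow> lab v \<in> \<Lambda>"
    and "\<And>v. v \<in> complex_vertices (boundary_complex T) \<Longrightarrow> lab v = neg (lab (- v))"
    and "\<And>\<sigma>. \<sigma> \<in> T \<Longrightarrow> simplex_labelling lab \<sigma> \<notin> F"
  shows "\<forall>i\<in>{1..n}. \<forall>P N.
    (\<forall>j<i - 1. opposite_partition neg (odd_labellings \<Lambda> F P j) (P j) (N j)) \<longrightarrow>
      strictly_symmetric neg (odd_labellings \<Lambda> F P (i - 1)) \<and>
      (\<exists>A B. opposite_partition neg (odd_labellings \<Lambda> F P (i - 1)) A B) \<and>
      (opposite_partition neg (odd_labellings \<Lambda> F P (i - 1)) (P (i - 1)) (N (i - 1)) \<longrightarrow>
        odd (card {\<sigma> \<in> Ts i. int i simplex \<sigma> \<and>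
                             simplex_labelling lab \<sigma> \<in> odd_labellings \<Lambda> F P i}))"
proof -
  note hemi = assms(4) and neg = assms(6)
  have Tsn: "Ts n = T" and ball: "\<And>i. i \<le> n \<Longrightarrow> triangulated_ball i (Ts i)"
    and union: "\<And>i. i < n \<Longrightarrow> Ts i \<union> antipodal (Ts i) = boundary_complex (Ts (Suc i))"
    and inter: "\<And>i. i < n \<Longrightarrow> Ts i \<inter> antipodal (Ts i) = boundary_complex (Ts i)"
    using hemi unfolding hemisphere_sequence_def
    by (blast, blast, (metis atLeastAtMost_iff diff_Suc_1 le_add1 plus_1_eq_Suc Suc_leI)+)
  have sub: "Ts i \<subseteq> T" if "i \<le> n" for i
    using hemisphere_sequence_mono [OF hemi that] Tsn by simp
  have lab: "lab v \<in> \<Lambda>" if "{v} \<in> Ts i" "i \<le> n" for v i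
    using that sub assms(11) by (auto simp: complex_vertices_def)
  \<comment> \<open>Below n every vertex lies on the boundary of \<open>T\<close>, since the
    hemispheres are nested. Solving the hypothesis for \<open>lab (- v)\<close> uses that
    \<open>neg\<close> is an involution on \<open>\<Lambda>\<close>, so \<open>- v\<close> must be
    known to be a vertex of \<open>T\<close>.\<close>
  have labneg: "lab (- v) = neg (lab v)" if "{v} \<in> Ts i" "i < n" for v i
  proof -
    have "Ts i \<subseteq> Ts (n - 1)" using hemisphere_sequence_mono [OF hemi, of i "n - 1"] that by simp
    also have "\<dots> \<subseteq> boundary_complex T"
      using union [of "n - 1"] assms(1) Tsn by auto
    finally have bd: "{v} \<in> boundary_complex T" using that by blast
    then have "uminus ` {v} \<in> boundary_complex T"
      using assms(3) unfolding antipodally_symmetric_boundary_def by blast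
    then have "lab (- v) \<in> \<Lambda>" using assms(11) by (auto simp: complex_vertices_def boundary_complex_def)
    moreover have "lab v = neg (lab (- v))" using bd assms(12) by (simp add: complex_vertices_def)
    ultimately show ?thesis using neg by (simp add: symmetric_labels_def)
  qed
  have odd: "odd (card {\<sigma> \<in> Ts i. int i simplex \<sigma> \<and> simplex_labelling lab \<sigma> \<in> odd_labellings \<Lambda> F P i})"
    if "i \<le> n" "\<forall>j<i. opposite_partition neg (odd_labellings \<Lambda> F P j) (P j) (N j)" for i P N
    using that
  proof (induction i)
    case 0
    show ?case using odd_card_zero [OF ball [of 0]] lab [of _ 0] by blast
  next
    case (Suc i)
    show ?case
    proof (rule odd_card_step [OF ball ball union inter neg])
      show "opposite_partition neg (odd_labellings \<Lambda> F P i) (P i) (N i)" using Suc.prems by blast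
      show "odd (card {\<sigma> \<in> Ts i. int i simplex \<sigma> \<and> simplex_labelling lab \<sigma> \<in> odd_labellings \<Lambda> F P i})"
        using Suc by simp
      show "simplex_labelling lab \<sigma> \<notin> F" if "\<sigma> \<in> Ts (Suc i)" for \<sigma>
        using that sub [OF Suc.prems(1)] assms(13) by blast
    qed (use Suc.prems lab labneg in auto)
  qed
  show ?thesis
  proof (intro ballI allI impI)
    fix i P N
    assume i: "i \<in> {1..n}"
      and part: "\<forall>j<i - 1. opposite_partition neg (odd_labellings \<Lambda> F P j) (P j) (N j)"
    have strict: "strictly_symmetric neg (odd_labellings \<Lambda> F P (i - 1))"
    proof (rule strictly_symmetric_odd_labellings [OF neg assms(8), of _ P N])
      show "strictly_symmetric neg (labellings \<Lambda> (i - 1) - F)"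
        using i by (intro assms(9)) auto
      show "l \<in> F" if "l \<in> labellings \<Lambda> (i - 1)" "m \<in># facet_labellings l" "m \<in> F" for l m
        using F_upward_closed [OF _ that] i by auto
    qed (use part in simp)
    moreover have "\<exists>A B. opposite_partition neg (odd_labellings \<Lambda> F P (i - 1)) A B"
      using strictly_symmetric_imp_opposite_partition [OF neg strict odd_labellings_subset] .
    moreover have "odd (card {\<sigma> \<in> Ts i. int i simplex \<sigma> \<and> simplex_labelling lab \<sigma> \<in> odd_labellings \<Lambda> F P i})"
      if "opposite_partition neg (odd_labellings \<Lambda> F P (i - 1)) (P (i - 1)) (N (i - 1))"
    proof (rule odd)
      show "i \<le> n" using i by simp
      show "\<forall>j<i. opposite_partition neg (odd_labellings \<Lambda> F P j) (P j) (N j)"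
      proof (intro allI impI)
        fix j assume "j < i"
        then have "j < i - 1 \<or> j = i - 1" by linarith
        then show "opposite_partition neg (odd_labellings \<Lambda> F P j) (P j) (N j)"
          using part that by blast
      qed
    qed
    ultimately show "strictly_symmetric neg (odd_labellings \<Lambda> F P (i - 1)) \<and>
      (\<exists>A B. opposite_partition neg (odd_labellings \<Lambda> F P (i - 1)) A B) \<and>
      (opposite_partition neg (odd_labellings \<Lambda> F P (i - 1)) (P (i - 1)) (N (i - 1)) \<longrightarrow>
        odd (card {\<sigma> \<in> Ts i. int i simplex \<sigma> \<and>
                             simplex_labelling lab \<sigma> \<in> odd_labellings \<Lambda> F P i}))"
      by blast
  qed
qed

end
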